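(* Let $N,m,n$ be positive integers, let $f:\mathbb R^N\to\,]-\infty,+\infty]$ be a proper lower semicontinuous convex function, let $R$ and $S$ be real matrices of sizes $m\times N$ and $n\times N$, respectively, with $RR^*$ invertible, and let $c\in\mathbb R^m$, $d\in\mathbb R^n$. Set $L:\mathbb R^N\to\mathbb R^{m+n}$, $x\mapsto(Rx,Sx)$, and $b=(c,d)\in\mathbb R^{m+n}$. Assume that the problem $$\min_{x\in\mathbb R^N} f(x)\quad\text{s.t.}\quad Rx=c,\ \ Sx=d$$ has a solution and that $0\in\operatorname{sri}(L(\operatorname{dom}f)-b)$. Let $\gamma>0$ and $\tau>0$ be such that $\gamma\tau\|L\|^2<1$, let $(x^0,\bar x^0,u^0)\in\mathbb R^N\times\mathbb R^N\times\mathbb R^{m+n}$ be such that $x^0=\bar x^0$, and define, for every $k\in\mathbb N$, $$\begin{aligned} u^{k+1}&=u^k+\gamma(L\bar x^k-b),\\ p^{k+1}&=\operatorname{prox}_{\tau f}(x^k-\tau L^*u^{k+1}),\\ x^{k+1}&=p^{k+1}-R^*(RR^* )^{-1}(Rp^{k+1}-c),\\ \bar x^{k+1}&=x^{k+1}+p^{k+1}-x^k. \end{aligned}$$ Then there exist a solution $\hat x$ to the problem of minimizing $f(x)$ over $x\in\mathbb R^N$ subject to $Rx=c$ and $Sx=d$, and an associated multiplier $\hat u\in\mathbb R^{m+n}$, such that $x^k\to\hat x$ and $u^k\to\hat u$.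
   Context: $\operatorname{dom}f=\{x: f(x)<+\infty\}$. $R^*$ and $L^*$ are the transposes (adjoints), and $\|L\|$ is the operator norm for Euclidean norms. $\operatorname{prox}_{\tau f}(z)$ is the unique minimizer of $y\mapsto \tau f(y)+\frac12\|y-z\|^2$. $\operatorname{sri}$ denotes the strong relative interior, which for convex sets in $\mathbb R^{m+n}$ is the relative interior. An associated multiplier for a solution $\hat x$ is a vector $\hat u\in\mathbb R^{m+n}$ such that $-L^*\hat u\in\partial f(\hat x)$, where $\partial f$ is the convex subdifferential (with $L\hat x=b$ holding by feasibility). *)

theory Defs
  imports "HOL-Analysis.Analysis"
begin

definition edom :: "('a \<Rightarrow> ereal) \<Rightarrow> 'a set" where
  "edom f = {x. f x < \<infinity>}"

definition proper_fun :: "('a \<Rightarrow> ereal) \<Rightarrow> bool" where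
  "proper_fun f \<longleftrightarrow> (\<forall>x. f x \<noteq> -\<infinity>) \<and> edom f \<noteq> {}"

text \<open>The filter \<^term>\<open>at x\<close> omits the point \<^term>\<open>x\<close> itself; including it would give the same condition.\<close>

definition lsc_fun :: "('a::topological_space \<Rightarrow> ereal) \<Rightarrow> bool" where
  "lsc_fun f \<longleftrightarrow> (\<forall>x. f x \<le> Liminf (at x) f)"

text \<open>The library's \<^const>\<open>convex_on\<close> covers only real-valued functions. The predicate is meant for
  functions that avoid \<^term>\<open>-\<infinity>::ereal\<close>, so that no \<open>\<infinity> - \<infinity>\<close> arises on the right-hand side.\<close>

definition econvex_fun :: "('a::real_vector \<Rightarrow> ereal) \<Rightarrow> bool" where
  "econvex_fun f \<longleftrightarrow> (\<forall>x y. \<forall>t::real. 0 < t \<and> t < 1 \<longrightarrow>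
     f ((1 - t) *\<^sub>R x + t *\<^sub>R y) \<le> ereal (1 - t) * f x + ereal t * f y)"

definition subdifferential :: "('a::real_inner \<Rightarrow> ereal) \<Rightarrow> 'a \<Rightarrow> 'a set" where
  "subdifferential f x = {v. \<forall>y. f x + ereal ((y - x) \<bullet> v) \<le> f y}"

text \<open>\<open>prox \<tau> f z\<close> is the proximity operator of \<open>\<tau> f\<close> at \<open>z\<close>. The minimizer exists and is
  unique when \<open>f\<close> is proper, lower semicontinuous and convex on a Euclidean space and \<open>\<tau> > 0\<close>;
  otherwise the value may be unspecified.\<close>

definition prox :: "real \<Rightarrow> ('a::real_inner \<Rightarrow> ereal) \<Rightarrow> 'a \<Rightarrow> 'a" where
  "prox \<tau> f z = (THE p. is_arg_min (\<lambda>y. ereal \<tau> * f y + ereal (1 / 2 * (norm (y - z))\<^sup>2)) (\<lambda>y. True) p)"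

end

theory Submission
  imports Defs
begin

text \<open>By the qualification condition the problem has a saddle point \<open>(xh, uh)\<close>. Put \<open>q = xbar - x\<close>. The energy
  \<open>|x - xh|\<^sup>2 / \<tau> + |u - uh|\<^sup>2 / \<gamma> + 2 (u - uh) \<bullet> L q + |q|\<^sup>2 / \<tau>\<close> decreases along the iteration: monotonicity
  of the subdifferential controls the proximal step, and Pythagoras' theorem the projection. Since
  \<open>\<gamma> \<tau> |L|\<^sup>2 < 1\<close>, the energy dominates the squared distance to the saddle point, and \<open>q\<close>, \<open>x - p\<close> and the
  increments of \<open>u\<close> tend to \<open>0\<close>. Hence a cluster point exists and is itself a saddle point; the energy taken
  relative to it converges and tends to \<open>0\<close> along a subsequence, so the whole sequence converges.\<close>

section \<open>Subgradients and lower semicontinuity\<close>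

lemma subdifferentialD:
  "v \<in> subdifferential f x \<Longrightarrow> f x + ereal ((y - x) \<bullet> v) \<le> f y"
  by (simp add: subdifferential_def)

text \<open>Were \<open>f x\<close> equal to \<infinity>, the subgradient inequality would make
  \<open>f\<close> infinite everywhere, against properness.\<close>

lemma subdifferential_finite:
  assumes "proper_fun f" and "v \<in> subdifferential f x"
  obtains r where "f x = ereal r"
proof -
  obtain y where y: "f y < \<infinity>"
    using assms(1) by (auto simp: proper_fun_def edom_def)
  have "f x + ereal ((y - x) \<bullet> v) \<le> f y"
    by (rule subdifferentialD[OF assms(2)])
  with y have "f x \<noteq> \<infinity>" by auto
  moreover have "f x \<noteq> -\<infinity>" using assms(1) by (simp add: proper_fun_def)
  ultimately show thesis using that by (cases "f x") auto
qed

text \<open>Adding the subgradient inequalities at both points cancels the function values, which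
  are real numbers.\<close>

lemma subdifferential_monotone:
  assumes "proper_fun f" and v: "v \<in> subdifferential f x" and w: "w \<in> subdifferential f y"
  shows "0 \<le> (x - y) \<bullet> (v - w)"
proof -
  obtain r s where r: "f x = ereal r" and s: "f y = ereal s"
    using subdifferential_finite assms by metis
  have "r + (y - x) \<bullet> v \<le> s" using subdifferentialD[OF v, of y] r s by simp
  moreover have "s + (x - y) \<bullet> w \<le> r" using subdifferentialD[OF w, of x] r s by simp
  ultimately show ?thesis by (simp add: inner_diff_left inner_diff_right)
qed

text \<open>The filter in \<open>lsc_fun\<close> omits \<open>x\<close>; the assumption
  \<open>r < f x\<close> supplies that point, so the bound holds on a full neighbourhood.\<close>

lemma lsc_fun_eventually:
  assumes "lsc_fun f" and "r < f x"
  shows "eventually (\<lambda>y. r < f y) (nhds x)"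
proof -
  have "f x \<le> Liminf (at x) f" using assms(1) by (simp add: lsc_fun_def)
  then have "eventually (\<lambda>y. r < f y) (at x)"
    using assms(2) by (simp add: le_Liminf_iff)
  then show ?thesis
    using assms(2) by (auto simp: eventually_at_filter elim!: eventually_mono)
qed

text \<open>A real level strictly between \<open>l\<close> and \<open>f x\<close> would eventually
  lie below \<open>f (X k)\<close> by semicontinuity and above \<open>a k\<close> by
  convergence.\<close>

lemma lsc_fun_le_limit:
  assumes lsc: "lsc_fun f" and X: "X \<longlonglongrightarrow> x" and a: "a \<longlonglongrightarrow> l"
    and le: "\<And>k. f (X k) \<le> ereal (a k)"
  shows "f x \<le> ereal l"
proof (rule ccontr)
  assume "\<not> f x \<le> ereal l"
  then obtain r where r: "ereal l < ereal r" "ereal r < f x"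
    by (metis not_le ereal_dense2)
  have "eventually (\<lambda>k. ereal r < f (X k)) sequentially"
    using lsc_fun_eventually[OF lsc r(2)] X by (rule eventually_compose_filterlim)
  moreover have "eventually (\<lambda>k. a k < r) sequentially"
    using a r(1) by (auto intro: order_tendstoD)
  ultimately have "eventually (\<lambda>k. False) sequentially"
  proof eventually_elim
    case (elim k)
    then have "ereal r < ereal (a k)" using le[of k] by (meson less_le_trans)
    with elim(2) show ?case by simp
  qed
  then show False by simp
qed

text \<open>Where \<open>f y\<close> is real, the subgradient inequality bounds
  \<open>f (X k)\<close> above by a convergent real sequence; lower semicontinuity carries this
  bound to the limit.\<close>

lemma subdifferential_closed_graph:
  assumes "proper_fun f" and lsc: "lsc_fun f" and X: "X \<longlonglongrightarrow> x" and V: "V \<longlonglongrightarrow> v"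
    and sub: "\<And>k. V k \<in> subdifferential f (X k)"
  shows "v \<in> subdifferential f x"
  unfolding subdifferential_def
proof (intro CollectI allI)
  fix y
  show "f x + ereal ((y - x) \<bullet> v) \<le> f y"
  proof (cases "f y")
    case (real r)
    have le: "f (X k) \<le> ereal (r - (y - X k) \<bullet> V k)" for k
    proof -
      obtain s where s: "f (X k) = ereal s"
        using subdifferential_finite assms(1) sub by metis
      then show ?thesis using subdifferentialD[OF sub[of k], of y] real by simp
    qed
    have lim: "(\<lambda>k. r - (y - X k) \<bullet> V k) \<longlonglongrightarrow> r - (y - x) \<bullet> v"
      by (intro tendsto_intros X V)
    have "f x \<le> ereal (r - (y - x) \<bullet> v)"
      by (rule lsc_fun_le_limit[OF lsc X lim le])
    then show ?thesis using real by (cases "f x") auto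
  qed (use assms(1) in \<open>auto simp: proper_fun_def\<close>)
qed

section \<open>The proximity operator: existence, optimality condition, uniqueness\<close>

text \<open>Without a minimum, the open sets \<open>U y\<close> with \<open>y\<close> in
  \<open>K\<close>, on which \<open>g\<close> exceeds \<open>g y\<close>, cover \<open>K\<close>. In
  a finite subcover the index \<open>m\<close> of least value lies in some \<open>U y\<close>, so
  \<open>g y < g m\<close>, a contradiction. Only levels attained on \<open>K\<close> define such
  sets, hence the form of \<open>lsc\<close>.\<close>

lemma compact_attains_min:
  fixes g :: "'a::topological_space \<Rightarrow> 'b::linorder"
  assumes "compact K" and "K \<noteq> {}"
    and lsc: "\<And>x r. x \<in> K \<Longrightarrow> r \<in> g ` K \<Longrightarrow> r < g x \<Longrightarrow> eventually (\<lambda>y. r < g y) (nhds x)"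
  shows "\<exists>x\<in>K. \<forall>y\<in>K. g x \<le> g y"
proof (rule ccontr)
  assume "\<not> ?thesis"
  then have ex: "\<exists>y\<in>K. g y < g x" if "x \<in> K" for x
    using that by (auto simp: not_le)
  define U where "U y = interior {x. g y < g x}" for y
  have "K \<subseteq> \<Union> (U ` K)"
  proof
    fix x assume x: "x \<in> K"
    then obtain y where "y \<in> K" "g y < g x" using ex by blast
    with lsc x have "eventually (\<lambda>z. g y < g z) (nhds x)" by blast
    then have "x \<in> U y"
      by (auto simp: U_def interior_def eventually_nhds)
    with \<open>y \<in> K\<close> show "x \<in> \<Union> (U ` K)" by blast
  qed
  then obtain D where D: "D \<subseteq> K" "finite D" "K \<subseteq> (\<Union>y\<in>D. U y)"
    using compactE_image[OF \<open>compact K\<close>, of K U] by (auto simp: U_def)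
  have "D \<noteq> {}" using D \<open>K \<noteq> {}\<close> by auto
  define m where "m = arg_min_on g D"
  have m: "m \<in> D" "\<And>y. y \<in> D \<Longrightarrow> g m \<le> g y"
    unfolding m_def using arg_min_if_finite[OF \<open>finite D\<close> \<open>D \<noteq> {}\<close>, of g]
    by (auto simp: not_less[symmetric])
  then obtain y where "y \<in> D" "m \<in> U y" using D by blast
  then have "g y < g m" using interior_subset by (auto simp: U_def)
  with m(2)[OF \<open>y \<in> D\<close>] show False by simp
qed

lemma prox_objective_lsc:
  fixes f :: "'a::real_inner \<Rightarrow> ereal"
  assumes "proper_fun f" "lsc_fun f" "\<tau> > 0"
    and r: "r < ereal \<tau> * f x + ereal (1 / 2 * (norm (x - z))\<^sup>2)" (is "r < ?g x")
  shows "eventually (\<lambda>y. r < ?g y) (nhds x)"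
proof (cases r)
  case (real s)
  define h where "h y = 1 / 2 * (norm (y - z))\<^sup>2" for y
  \<comment> \<open>The level \<open>q\<close> splits the slack in \<open>r < ?g x\<close>: near
    \<open>x\<close>, \<open>f\<close> stays above \<open>q\<close> by semicontinuity and
    \<open>h\<close> above \<open>s - \<tau> * q\<close> by continuity, and the two bounds add up to
    \<open>s\<close>.\<close>
  have "ereal ((s - h x) / \<tau>) < f x"
    using r assms(1,3) unfolding h_def[symmetric] real
    by (cases "f x") (auto simp: field_simps proper_fun_def)
  then obtain q where q: "ereal ((s - h x) / \<tau>) < ereal q" "ereal q < f x"
    using ereal_dense2 by blast
  have "(h \<longlongrightarrow> h x) (nhds x)"
    unfolding h_def by (intro tendsto_intros filterlim_ident)
  moreover have "h x > s - \<tau> * q" using q(1) assms(3) by (simp add: field_simps)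
  ultimately have "eventually (\<lambda>y. s - \<tau> * q < h y) (nhds x)"
    by (auto intro: order_tendstoD)
  then show ?thesis using lsc_fun_eventually[OF assms(2) q(2)]
  proof eventually_elim
    case (elim y)
    show ?case
    proof (cases "f y")
      case (real t)
      with elim have "q < t" by simp
      then have "\<tau> * q < \<tau> * t" using assms(3) by simp
      with elim(1) show ?thesis unfolding h_def[symmetric] using real \<open>r = ereal s\<close> by simp
    qed (use assms(1,3) \<open>r = ereal s\<close> in \<open>auto simp: proper_fun_def\<close>)
  qed
next
  case MInf
  have "r < ?g y" for y
    using MInf assms(1,3) by (cases "f y") (auto simp: proper_fun_def)
  then show ?thesis by simp
qed (use r in auto)

text \<open>A subgradient at any point gives the affine minorant of \<open>f\<close> that makes the objective coercive.\<close>

lemma prox_objective_minimizer_exists: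
  fixes f :: "'a::euclidean_space \<Rightarrow> ereal"
  assumes pf: "proper_fun f" and lsc: "lsc_fun f" and \<tau>: "\<tau> > 0"
    and v: "v \<in> subdifferential f a"
  shows "\<exists>p. \<forall>y. ereal \<tau> * f p + ereal (1 / 2 * (norm (p - z))\<^sup>2)
           \<le> ereal \<tau> * f y + ereal (1 / 2 * (norm (y - z))\<^sup>2)" (is "\<exists>p. \<forall>y. ?g p \<le> ?g y")
proof -
  obtain s where s: "f a = ereal s" using subdifferential_finite[OF pf v] .
  define h where "h y = 1 / 2 * (norm (y - z))\<^sup>2" for y
  \<comment> \<open>Choice of the radius: \<open>h y - h a\<close> is half of
    \<open>(|y - z| + |a - z|) * (|y - z| - |a - z|)\<close>. Once the second factor exceeds
    \<open>2 * \<tau> * |v|\<close>, this outweighs the linear loss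
    \<open>\<tau> * |v| * |y - a|\<close> that the affine minorant allows.\<close>
  define B where "B = 2 * \<tau> * norm v + norm (a - z)"
  have B0: "norm (a - z) \<le> B" using \<tau> by (simp add: B_def)
  have out: "?g a \<le> ?g y" if "norm (y - z) > B" for y
  proof (cases "f y")
    case (real t)
    have "s + (y - a) \<bullet> v \<le> t" using subdifferentialD[OF v, of y] s real by simp
    then have "\<tau> * (s + (y - a) \<bullet> v) \<le> \<tau> * t" using \<tau> by simp
    moreover have "\<tau> * (- (norm (y - a) * norm v)) \<le> \<tau> * ((y - a) \<bullet> v)"
      using \<tau> Cauchy_Schwarz_ineq2[of "y - a" v] by (intro mult_left_mono) auto
    moreover have "\<tau> * (norm (y - a) * norm v) \<le> \<tau> * ((norm (y - z) + norm (a - z)) * norm v)"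
      using \<tau> norm_triangle_ineq4[of "y - z" "a - z"] by (intro mult_left_mono mult_right_mono) auto
    moreover have "\<tau> * ((norm (y - z) + norm (a - z)) * norm v) + h a \<le> h y"
    proof -
      have "(norm (y - z) + norm (a - z)) * (2 * \<tau> * norm v) \<le>
        (norm (y - z) + norm (a - z)) * (norm (y - z) - norm (a - z))"
        using that by (intro mult_left_mono) (auto simp: B_def)
      then show ?thesis by (simp add: h_def power2_eq_square algebra_simps)
    qed
    ultimately show ?thesis
      unfolding h_def[symmetric] using s real by (simp add: distrib_left)
  qed (use pf \<tau> in \<open>auto simp: proper_fun_def\<close>)
  have "\<exists>p\<in>cball z B. \<forall>y\<in>cball z B. ?g p \<le> ?g y"
  proof (rule compact_attains_min)
    show "cball z B \<noteq> {}" using B0 norm_ge_zero[of "a - z"] by (auto simp del: norm_ge_zero)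
  qed (use prox_objective_lsc[OF pf lsc \<tau>] in auto)
  then obtain p where p: "\<forall>y\<in>cball z B. ?g p \<le> ?g y" by blast
  have "a \<in> cball z B" using B0 by (simp add: dist_norm norm_minus_commute)
  have "?g p \<le> ?g y" for y
  proof (cases "norm (y - z) > B")
    case True
    then show ?thesis using p \<open>a \<in> cball z B\<close> out[of y] by (meson order_trans)
  next
    case False
    then have "y \<in> cball z B" by (simp add: dist_norm norm_minus_commute)
    then show ?thesis using p by blast
  qed
  then show ?thesis by blast
qed

text \<open>Fermat's rule by a directional argument: \<open>p\<close> is compared with points on the
  segment towards \<open>y\<close>, where convexity bounds \<open>f\<close>. After division by
  \<open>t\<close> the quadratic term leaves a remainder of order \<open>t\<close>, which vanishes
  as \<open>t\<close> decreases to 0.\<close>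

lemma prox_objective_minimizer_subdifferential:
  fixes f :: "'a::real_inner \<Rightarrow> ereal"
  assumes pf: "proper_fun f" and conv: "econvex_fun f" and \<tau>: "\<tau> > 0"
    and min: "\<And>y. ereal \<tau> * f p + ereal (1 / 2 * (norm (p - z))\<^sup>2)
           \<le> ereal \<tau> * f y + ereal (1 / 2 * (norm (y - z))\<^sup>2)"
  shows "(1 / \<tau>) *\<^sub>R (z - p) \<in> subdifferential f p"
  unfolding subdifferential_def
proof (intro CollectI allI)
  fix y
  obtain y0 where y0: "f y0 < \<infinity>"
    using pf by (auto simp: proper_fun_def edom_def)
  have "f p \<noteq> \<infinity>" using min[of y0] y0 \<tau> by (cases "f y0") auto
  then obtain s where s: "f p = ereal s"
    using pf by (cases "f p") (auto simp: proper_fun_def)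
  show "f p + ereal ((y - p) \<bullet> ((1 / \<tau>) *\<^sub>R (z - p))) \<le> f y"
  proof (cases "f y")
    case (real r)
    have ineq: "\<tau> * (s - r) \<le> (p - z) \<bullet> (y - p) + t / 2 * (norm (y - p))\<^sup>2"
      if t: "0 < t" "t < 1" for t
    proof -
      define w where "w = (1 - t) *\<^sub>R p + t *\<^sub>R y"
      have "f w \<le> ereal ((1 - t) * s + t * r)"
        using conv[unfolded econvex_fun_def, rule_format, of t p y] t s real by (simp add: w_def)
      moreover obtain q where q: "f w = ereal q"
        using calculation pf by (cases "f w") (auto simp: proper_fun_def)
      ultimately have "\<tau> * q \<le> \<tau> * ((1 - t) * s + t * r)" using \<tau> by simp
      moreover have "\<tau> * s + 1 / 2 * (norm (p - z))\<^sup>2 \<le> \<tau> * q + 1 / 2 * (norm (w - z))\<^sup>2"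
        using min[of w] s q by simp
      moreover have "(norm (w - z))\<^sup>2 =
          (norm (p - z))\<^sup>2 + 2 * t * ((p - z) \<bullet> (y - p)) + t\<^sup>2 * (norm (y - p))\<^sup>2"
      proof -
        have w: "w - z = (p - z) + t *\<^sub>R (y - p)" by (simp add: w_def algebra_simps)
        show ?thesis
          unfolding w power2_norm_eq_inner
          by (simp add: power2_eq_square inner_add_left inner_add_right inner_commute)
      qed
      ultimately have "t * (\<tau> * (s - r)) \<le> t * ((p - z) \<bullet> (y - p) + t / 2 * (norm (y - p))\<^sup>2)"
        by (simp add: algebra_simps power2_eq_square)
      then show ?thesis using t by simp
    qed
    have "\<tau> * (s - r) \<le> (p - z) \<bullet> (y - p)"
    proof (rule tendsto_le[of "at_right 0"])
      show "((\<lambda>t. (p - z) \<bullet> (y - p) + t / 2 * (norm (y - p))\<^sup>2) \<longlongrightarrow> (p - z) \<bullet> (y - p)) (at_right 0)"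
        by (auto intro!: tendsto_eq_intros)
      show "\<forall>\<^sub>F t in at_right 0. \<tau> * (s - r) \<le> (p - z) \<bullet> (y - p) + t / 2 * (norm (y - p))\<^sup>2"
        using ineq by (auto simp: eventually_at_right_field intro!: exI[of _ 1])
    qed auto
    then have "s - r \<le> (p - z) \<bullet> (y - p) / \<tau>" using \<tau> by (simp add: field_simps)
    moreover have "(y - p) \<bullet> ((1 / \<tau>) *\<^sub>R (z - p)) = - ((p - z) \<bullet> (y - p) / \<tau>)"
      by (simp add: inner_diff_left inner_diff_right inner_commute diff_divide_distrib add_divide_distrib)
    ultimately show ?thesis using s real by simp
  qed (use pf in \<open>auto simp: proper_fun_def\<close>)
qed

text \<open>Since \<open>prox\<close> is a definite description, uniqueness is part of the proof:
  two minimizers carry the subgradients \<open>(z - p) / \<tau>\<close> and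
  \<open>(z - p') / \<tau>\<close>, and monotonicity then forces \<open>|p' - p|^2 <= 0\<close>. The
  subgradient \<open>v\<close> provides existence.\<close>

lemma prox_subdifferential:
  fixes f :: "'a::euclidean_space \<Rightarrow> ereal"
  assumes pf: "proper_fun f" and lsc: "lsc_fun f" and conv: "econvex_fun f" and \<tau>: "\<tau> > 0"
    and v: "v \<in> subdifferential f a"
  shows "(1 / \<tau>) *\<^sub>R (z - prox \<tau> f z) \<in> subdifferential f (prox \<tau> f z)"
proof -
  let ?g = "\<lambda>y. ereal \<tau> * f y + ereal (1 / 2 * (norm (y - z))\<^sup>2)"
  have sub: "(1 / \<tau>) *\<^sub>R (z - p) \<in> subdifferential f p" if "is_arg_min ?g (\<lambda>y. True) p" for p
    using that by (intro prox_objective_minimizer_subdifferential[OF pf conv \<tau>]) (auto simp: is_arg_min_def not_less)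
  obtain p where p: "is_arg_min ?g (\<lambda>y. True) p"
    using prox_objective_minimizer_exists[OF pf lsc \<tau> v, of z] by (auto simp: is_arg_min_def not_less)
  have "p' = p" if "is_arg_min ?g (\<lambda>y. True) p'" for p'
  proof -
    have "0 \<le> (p' - p) \<bullet> ((1 / \<tau>) *\<^sub>R (z - p') - (1 / \<tau>) *\<^sub>R (z - p))"
      by (rule subdifferential_monotone[OF pf sub[OF that] sub[OF p]])
    also have "(1 / \<tau>) *\<^sub>R (z - p') - (1 / \<tau>) *\<^sub>R (z - p) = - ((1 / \<tau>) *\<^sub>R (p' - p))"
      by (simp add: scaleR_diff_right)
    finally have "(p' - p) \<bullet> (p' - p) \<le> 0" using \<tau> by (simp add: divide_simps)
    then show ?thesis by (metis inner_ge_zero inner_eq_zero_iff order_antisym eq_iff_diff_eq_0)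
  qed
  then have "prox \<tau> f z = p" unfolding prox_def using p by blast
  then show ?thesis using sub[OF p] by simp
qed

section \<open>Existence of a multiplier\<close>

text \<open>A hyperplane supports the epigraph of the value function at \<open>(0, f a)\<close>; the qualification
  condition excludes vertical ones, and its slope is the multiplier.\<close>

lemma multiplier_exists:
  fixes f :: "'a::euclidean_space \<Rightarrow> ereal" and L :: "'a \<Rightarrow> 'b::euclidean_space"
  assumes pf: "proper_fun f" and conv: "econvex_fun f" and L: "linear L"
    and min: "is_arg_min f (\<lambda>y. L y = b) a"
    and ri: "0 \<in> rel_interior ((\<lambda>z. L z - b) ` edom f)"
  shows "\<exists>w. - adjoint L w \<in> subdifferential f a"
proof -
  define D where "D = (\<lambda>z. L z - b) ` edom f"
  \<comment> \<open>The image of the epigraph of \<open>f\<close> under \<open>(z, r)\<close> to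
    \<open>(L z - b, r)\<close>: the first component is the perturbation of the constraint. Above
    perturbation 0 the least height is the optimal value.\<close>
  define G where "G = {(L z - b, r) | z r. f z \<le> ereal r}"
  have La: "L a = b" and amin: "\<And>y. L y = b \<Longrightarrow> f a \<le> f y"
    using min by (auto simp: is_arg_min_def not_less)
  have "0 \<in> D" using ri rel_interior_subset unfolding D_def by blast
  then obtain z0 where "f z0 < \<infinity>" "L z0 = b" by (auto simp: D_def edom_def)
  then have "f a < \<infinity>" using amin[of z0] by (meson le_less_trans)
  then obtain \<mu> where \<mu>: "f a = ereal \<mu>"
    using pf by (cases "f a") (auto simp: proper_fun_def)
  have inG: "(0, \<mu>) \<in> G" using \<mu> La by (force simp: G_def)
  have "convex G"
  proof (rule convexI)
    fix g h :: "'b \<times> real" and s t :: real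
    assume g: "g \<in> G" and h: "h \<in> G" and st: "0 \<le> s" "0 \<le> t" "s + t = 1"
    show "s *\<^sub>R g + t *\<^sub>R h \<in> G"
    \<comment> \<open>\<open>econvex_fun\<close> speaks of weights strictly between 0 and 1
      only.\<close>
    proof (cases "s = 0 \<or> t = 0")
      case True
      then show ?thesis using g h st by auto
    next
      case False
      obtain y q where y: "g = (L y - b, q)" "f y \<le> ereal q" using g by (auto simp: G_def)
      obtain z r where z: "h = (L z - b, r)" "f z \<le> ereal r" using h by (auto simp: G_def)
      have s: "s = 1 - t" "0 < t" "t < 1" using st False by auto
      have "f (s *\<^sub>R y + t *\<^sub>R z) \<le> ereal s * f y + ereal t * f z"
        using conv s by (auto simp: econvex_fun_def)
      also have "\<dots> \<le> ereal s * ereal q + ereal t * ereal r"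
        using y z st by (intro add_mono ereal_mult_left_mono) auto
      finally have "f (s *\<^sub>R y + t *\<^sub>R z) \<le> ereal (s * q + t * r)" by simp
      moreover have "s *\<^sub>R g + t *\<^sub>R h = (L (s *\<^sub>R y + t *\<^sub>R z) - b, s * q + t * r)"
      proof -
        have "- (s *\<^sub>R b) - t *\<^sub>R b = - b"
          using st(3) by (metis minus_add_distrib diff_conv_add_uminus scaleR_add_left scaleR_one)
        then show ?thesis
          by (simp add: y z linear_add[OF L] linear_scale[OF L] scaleR_diff_right)
      qed
      ultimately show ?thesis unfolding G_def by blast
    qed
  qed
  \<comment> \<open>From a relative interior point one could go on slightly beyond the segment that
    descends from \<open>(0, \<mu> + 1)\<close>, reaching a feasible value below the minimum
    \<open>\<mu>\<close>.\<close>
  have notri: "(0, \<mu>) \<notin> rel_interior G"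
  proof
    assume ri: "(0, \<mu>) \<in> rel_interior G"
    have "(0, \<mu> + 1) \<in> affine hull G" using \<mu> La by (intro hull_inc) (force simp: G_def)
    then obtain e where e: "e > 1" "(1 - e) *\<^sub>R (0, \<mu> + 1) + e *\<^sub>R (0::'b, \<mu>) \<in> G"
      using bspec[OF convex_rel_interior_if2[OF \<open>convex G\<close> ri]] by blast
    then have "(0, \<mu> - (e - 1)) \<in> G" by (simp add: algebra_simps)
    then obtain z where "L z = b" "f z \<le> ereal (\<mu> - (e - 1))" by (auto simp: G_def)
    then have "ereal \<mu> \<le> ereal (\<mu> - (e - 1))" using amin[of z] \<mu> by (metis order_trans)
    with e(1) show False by simp
  qed
  obtain c where c: "\<And>y. y \<in> G \<Longrightarrow> c \<bullet> (0, \<mu>) \<le> c \<bullet> y"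
    "\<And>y. y \<in> rel_interior G \<Longrightarrow> c \<bullet> (0, \<mu>) < c \<bullet> y"
    using supporting_hyperplane_rel_boundary[OF \<open>convex G\<close> inG notri] by metis
  obtain w s where ws: "c = (w, s)" by (cases c)
  have sep: "s * \<mu> \<le> w \<bullet> (L z - b) + s * r" if "f z \<le> ereal r" for z r
    using c(1)[of "(L z - b, r)"] that by (auto simp: ws G_def)
  \<comment> \<open>\<open>G\<close> is closed under moving upwards, so the height coefficient
    cannot be negative.\<close>
  have "s \<ge> 0" using sep[of a "\<mu> + 1"] \<mu> La by (simp add: distrib_left)
  \<comment> \<open>If the hyperplane were vertical, \<open>w\<close> would be nonnegative on
    \<open>D\<close>, and positive at some point of \<open>D\<close> because the separation is
    strict on the relative interior of \<open>G\<close>. As 0 is in the relative interior of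
    \<open>D\<close>, the segment from that point to 0 extends beyond 0 within \<open>D\<close>,
    where \<open>w\<close> is negative.\<close>
  have "s \<noteq> 0"
  proof
    assume s0: "s = 0"
    have nonneg: "0 \<le> w \<bullet> y" if "y \<in> D" for y
    proof -
      obtain z where z: "y = L z - b" "f z < \<infinity>" using \<open>y \<in> D\<close> by (auto simp: D_def edom_def)
      then obtain r where "f z = ereal r" using pf by (cases "f z") (auto simp: proper_fun_def)
      then show ?thesis using sep[of z r] z s0 by simp
    qed
    obtain g where g: "g \<in> rel_interior G"
      using rel_interior_eq_empty[OF \<open>convex G\<close>] inG by blast
    then obtain z r where z: "g = (L z - b, r)" "f z \<le> ereal r"
      using rel_interior_subset by (fastforce simp: G_def)
    have zD: "L z - b \<in> D" using z(2) by (auto simp: D_def edom_def)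
    have pos: "0 < w \<bullet> (L z - b)" using c(2)[OF g] by (simp add: ws s0 z)
    have "D = fst ` G"
    proof
      show "D \<subseteq> fst ` G"
      proof
        fix y assume "y \<in> D"
        then obtain z where z: "y = L z - b" "f z < \<infinity>" by (auto simp: D_def edom_def)
        then obtain r where "f z \<le> ereal r" using pf by (cases "f z") (auto simp: proper_fun_def)
        with z show "y \<in> fst ` G" by (force simp: G_def)
      qed
    qed (auto simp: G_def D_def edom_def)
    then have "convex D" using convex_linear_image[OF linear_fst \<open>convex G\<close>] by simp
    then obtain e where e: "e > 1" "(1 - e) *\<^sub>R (L z - b) + e *\<^sub>R 0 \<in> D"
      using bspec[OF convex_rel_interior_if2[OF _ ri[folded D_def]] hull_inc[OF zD]] by blast
    then have "0 \<le> (1 - e) * (w \<bullet> (L z - b))" using nonneg by fastforce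
    then show False using pos e(1) by (simp add: zero_le_mult_iff)
  qed
  with \<open>s \<ge> 0\<close> have s: "s > 0" by simp
  \<comment> \<open>Dividing by \<open>s\<close> normalizes the height coefficient to 1; with
    \<open>L a = b\<close>, \<open>sep\<close> becomes the subgradient inequality at
    \<open>a\<close>.\<close>
  have "f a + ereal ((y - a) \<bullet> (- adjoint L ((1 / s) *\<^sub>R w))) \<le> f y" for y
  proof (cases "f y")
    case (real r)
    have "\<mu> \<le> (w \<bullet> (L y - b)) / s + r" using sep[of y r] real s by (simp add: field_simps)
    moreover have "(y - a) \<bullet> (- adjoint L ((1 / s) *\<^sub>R w)) = - (w \<bullet> (L y - b)) / s"
      using adjoint_works[OF L, of "y - a" "(1 / s) *\<^sub>R w"] La
      by (simp add: linear_diff[OF L] inner_commute)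
    ultimately show ?thesis using real \<mu> by simp
  qed (use pf in \<open>auto simp: proper_fun_def\<close>)
  then show ?thesis unfolding subdifferential_def by blast
qed

section \<open>The energy and its decrease\<close>

text \<open>The argument \<open>q\<close> stands for \<open>xbar - x\<close>.\<close>

definition pd_energy ::
  "('a::real_inner \<Rightarrow> 'b::real_inner) \<Rightarrow> real \<Rightarrow> real \<Rightarrow> 'a \<Rightarrow> 'b \<Rightarrow> 'a \<Rightarrow> 'b \<Rightarrow> 'a \<Rightarrow> real" where
  "pd_energy L \<tau> \<gamma> xh uh x u q =
     (norm (x - xh))\<^sup>2 / \<tau> + (norm (u - uh))\<^sup>2 / \<gamma> + 2 * ((u - uh) \<bullet> L q) + (norm q)\<^sup>2 / \<tau>"

text \<open>Cauchy-Schwarz, then the inequality between arithmetic and geometric means for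
  \<open>|w| / sqrt \<gamma>\<close> and \<open>|v| / sqrt \<tau>\<close>. These weights reproduce
  the squares of the energy, and the constant is below 1 exactly under the step size
  condition.\<close>

lemma weighted_coupling_bound:
  assumes "bounded_linear L" "\<gamma> > 0" "\<tau> > 0"
  shows "2 * \<bar>w \<bullet> L v\<bar> \<le> onorm L * sqrt (\<gamma> * \<tau>) * ((norm w)\<^sup>2 / \<gamma> + (norm v)\<^sup>2 / \<tau>)"
proof -
  have "\<bar>w \<bullet> L v\<bar> \<le> norm w * norm (L v)" by (rule Cauchy_Schwarz_ineq2)
  also have "\<dots> \<le> norm w * (onorm L * norm v)"
    by (intro mult_left_mono onorm assms) auto
  finally have 1: "2 * \<bar>w \<bullet> L v\<bar> \<le> onorm L * (2 * (norm w * norm v))"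
    by (simp add: mult.left_commute)
  have "2 * (norm w / sqrt \<gamma>) * (norm v / sqrt \<tau>) \<le> (norm w / sqrt \<gamma>)\<^sup>2 + (norm v / sqrt \<tau>)\<^sup>2"
    by (rule sum_squares_bound)
  then have "sqrt (\<gamma> * \<tau>) * (2 * (norm w / sqrt \<gamma>) * (norm v / sqrt \<tau>))
    \<le> sqrt (\<gamma> * \<tau>) * ((norm w)\<^sup>2 / \<gamma> + (norm v)\<^sup>2 / \<tau>)"
    using assms by (intro mult_left_mono) (auto simp: power_divide)
  then have "2 * (norm w * norm v) \<le> sqrt (\<gamma> * \<tau>) * ((norm w)\<^sup>2 / \<gamma> + (norm v)\<^sup>2 / \<tau>)"
    using assms by (simp add: real_sqrt_mult)
  then have "onorm L * (2 * (norm w * norm v)) \<le> onorm L * (sqrt (\<gamma> * \<tau>) * ((norm w)\<^sup>2 / \<gamma> + (norm v)\<^sup>2 / \<tau>))"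
    by (intro mult_left_mono onorm_pos_le assms)
  with 1 show ?thesis by (simp add: mult.assoc)
qed

text \<open>The coupling term consumes at most the fraction
  \<open>onorm L * sqrt (\<gamma> * \<tau>)\<close> of the two squares that it joins; the square of
  \<open>x - xh\<close> is intact and is merely weakened to the common factor.\<close>

lemma pd_energy_lower_bound:
  assumes L: "bounded_linear L" and pos: "\<gamma> > 0" "\<tau> > 0"
  shows "(1 - onorm L * sqrt (\<gamma> * \<tau>)) * ((norm (x - xh))\<^sup>2 / \<tau> + (norm (u - uh))\<^sup>2 / \<gamma> + (norm q)\<^sup>2 / \<tau>)
    \<le> pd_energy L \<tau> \<gamma> xh uh x u q"
proof -
  have "0 \<le> onorm L * sqrt (\<gamma> * \<tau>) * ((norm (x - xh))\<^sup>2 / \<tau>)"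
    using pos onorm_pos_le[OF L] by simp
  then show ?thesis
    using weighted_coupling_bound[OF L pos, of "u - uh" q]
    unfolding pd_energy_def distrib_left left_diff_distrib mult_1_left by linarith
qed

text \<open>One step of the iteration, with \<open>L xh\<close> in the place of \<open>b\<close>.
  The proximal step enters through \<open>mono\<close> and the projection through
  \<open>proj\<close>; the new extrapolation \<open>xbar' - x'\<close> is \<open>p - x\<close>.
  Polarization turns the inner products of both steps into differences of squared distances.\<close>

lemma pd_energy_decrease:
  assumes L: "bounded_linear L" and pos: "\<gamma> > 0" "\<tau> > 0"
    and u': "u' = u + \<gamma> *\<^sub>R (L (x + q) - L xh)"
    and mono: "\<tau> * (L (p - xh) \<bullet> (u' - uh)) \<le> (x - p) \<bullet> (p - xh)"
    and proj: "(norm (p - xh))\<^sup>2 = (norm (x' - xh))\<^sup>2 + (norm (x' - p))\<^sup>2"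
  shows "pd_energy L \<tau> \<gamma> xh uh x' u' (p - x) + (norm (x' - p))\<^sup>2 / \<tau>
      + (1 - onorm L * sqrt (\<gamma> * \<tau>)) * ((norm (u' - u))\<^sup>2 / \<gamma> + (norm q)\<^sup>2 / \<tau>)
    \<le> pd_energy L \<tau> \<gamma> xh uh x u q"
proof -
  interpret L: bounded_linear L by (rule L)
  have primal: "2 * ((x - p) \<bullet> (p - xh)) = (norm (x - xh))\<^sup>2 - (norm (p - xh))\<^sup>2 - (norm (p - x))\<^sup>2"
    by (simp add: power2_norm_eq_inner inner_diff_left inner_diff_right inner_commute)
  have "2 * (L (p - xh) \<bullet> (u' - uh)) \<le> 2 * ((x - p) \<bullet> (p - xh)) / \<tau>"
    using mono pos by (simp add: field_simps)
  \<comment> \<open>\<open>proj\<close> replaces the distance of \<open>p\<close> by that of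
    \<open>x'\<close> and leaves \<open>|x' - p|^2\<close> as a gain.\<close>
  also have "\<dots> = (norm (x - xh))\<^sup>2 / \<tau> - (norm (x' - xh))\<^sup>2 / \<tau> - (norm (x' - p))\<^sup>2 / \<tau> - (norm (p - x))\<^sup>2 / \<tau>"
    unfolding primal proj by (simp add: diff_divide_distrib add_divide_distrib)
  finally have P: "2 * (L (p - xh) \<bullet> (u' - uh)) \<le> \<dots>" .
  \<comment> \<open>Expanded around the new iterate \<open>u'\<close>, because \<open>mono\<close>
    pairs with \<open>u' - uh\<close>.\<close>
  have "(norm (u - uh))\<^sup>2 = (norm (u' - uh))\<^sup>2 + (norm (u' - u))\<^sup>2 - 2 * ((u' - uh) \<bullet> (u' - u))"
    by (simp add: power2_norm_eq_inner inner_diff_left inner_diff_right inner_commute)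
  also have "u' - u = \<gamma> *\<^sub>R L (x + q - xh)" unfolding u' by (simp add: L.diff L.add)
  then have "(u' - uh) \<bullet> (u' - u) = \<gamma> * ((u' - uh) \<bullet> L (x + q - xh))" by simp
  finally have D: "(norm (u - uh))\<^sup>2 / \<gamma> =
      (norm (u' - uh))\<^sup>2 / \<gamma> + (norm (u' - u))\<^sup>2 / \<gamma> - 2 * ((u' - uh) \<bullet> L (x + q - xh))"
    using pos by (simp add: field_simps)
  \<comment> \<open>The \<open>p - x\<close> and \<open>q\<close> couplings belong to the new and the old energy; only the last one must be absorbed.\<close>
  have C: "(u' - uh) \<bullet> L (x + q - xh) =
      L (p - xh) \<bullet> (u' - uh) - (u' - uh) \<bullet> L (p - x) + (u - uh) \<bullet> L q + (u' - u) \<bullet> L q"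
    by (simp add: L.diff L.add inner_diff_left inner_diff_right inner_add_left inner_add_right inner_commute)
  have B: "2 * ((u' - u) \<bullet> L q) \<le> onorm L * sqrt (\<gamma> * \<tau>) * ((norm (u' - u))\<^sup>2 / \<gamma> + (norm q)\<^sup>2 / \<tau>)"
    using weighted_coupling_bound[OF L pos, of "u' - u" q] by linarith
  have "(1 - onorm L * sqrt (\<gamma> * \<tau>)) * ((norm (u' - u))\<^sup>2 / \<gamma> + (norm q)\<^sup>2 / \<tau>) =
     (norm (u' - u))\<^sup>2 / \<gamma> + (norm q)\<^sup>2 / \<tau> - onorm L * sqrt (\<gamma> * \<tau>) * ((norm (u' - u))\<^sup>2 / \<gamma> + (norm q)\<^sup>2 / \<tau>)"
    by (simp add: left_diff_distrib)
  then show ?thesis unfolding pd_energy_def using P D B C by linarith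
qed

section \<open>Convergence of the iteration\<close>

text \<open>\<open>E\<close> decreases and is bounded below, hence converges; its successive
  differences then tend to 0 and dominate \<open>\<delta>\<close>.\<close>

lemma energy_decrements_vanish:
  fixes E \<delta> :: "nat \<Rightarrow> real"
  assumes E: "\<And>k. 0 \<le> E k" and \<delta>: "\<And>k. 0 \<le> \<delta> k" and le: "\<And>k. E (Suc k) + \<delta> k \<le> E k"
  shows "convergent E" "\<delta> \<longlonglongrightarrow> 0"
proof -
  have "decseq E" using \<delta> le by (intro decseq_SucI) (smt (verit))
  then obtain l where l: "E \<longlonglongrightarrow> l" using decseq_convergent[of E 0] E by blast
  then show "convergent E" by (rule convergentI)
  have "(\<lambda>k. E k - E (Suc k)) \<longlonglongrightarrow> l - l" by (intro tendsto_diff l LIMSEQ_Suc)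
  then have lim: "(\<lambda>k. E k - E (Suc k)) \<longlonglongrightarrow> 0" by simp
  show "\<delta> \<longlonglongrightarrow> 0"
  proof (rule tendsto_sandwich[OF _ _ tendsto_const lim])
    show "eventually (\<lambda>k. \<delta> k \<le> E k - E (Suc k)) sequentially"
      using le by (intro always_eventually) (auto simp: algebra_simps)
  qed (use \<delta> in auto)
qed

lemma tendsto_of_norm_square_le:
  fixes x :: "nat \<Rightarrow> 'a::real_normed_vector"
  assumes "E \<longlonglongrightarrow> 0" and "\<And>k. (norm (x k - a))\<^sup>2 \<le> C * E k"
  shows "x \<longlonglongrightarrow> a"
proof -
  have "(\<lambda>k. C * E k) \<longlonglongrightarrow> 0" using tendsto_mult_right_zero[OF assms(1)] .
  then have "(\<lambda>k. (norm (x k - a))\<^sup>2) \<longlonglongrightarrow> 0"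
    by (rule tendsto_sandwich[OF _ _ tendsto_const, rotated 2]) (use assms(2) in auto)
  then have "(\<lambda>k. norm (x k - a)) \<longlonglongrightarrow> 0"
    using tendsto_real_sqrt by fastforce
  then show ?thesis by (simp add: LIM_zero_iff tendsto_norm_zero_iff)
qed

text \<open>An abstract form of the algorithm: the proximity operator appears as an inclusion and
  the projection as a Pythagorean identity at every feasible point. Here \<open>p k\<close> is the
  proximal point computed from \<open>x k\<close>.\<close>

lemma projected_primal_dual_convergence:
  fixes f :: "'a::euclidean_space \<Rightarrow> ereal" and L :: "'a \<Rightarrow> 'b::euclidean_space"
    and x q p :: "nat \<Rightarrow> 'a" and u :: "nat \<Rightarrow> 'b"
  assumes pf: "proper_fun f" and lsc: "lsc_fun f" and L: "linear L"
    and pos: "\<gamma> > 0" "\<tau> > 0" and step: "\<gamma> * \<tau> * (onorm L)\<^sup>2 < 1"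
    and saddle: "L xh = b" "- adjoint L uh \<in> subdifferential f xh"
    and u: "\<And>k. u (Suc k) = u k + \<gamma> *\<^sub>R (L (x k + q k) - b)"
    and p: "\<And>k. (1 / \<tau>) *\<^sub>R (x k - p k) - adjoint L (u (Suc k)) \<in> subdifferential f (p k)"
    and q: "\<And>k. q (Suc k) = p k - x k"
    and proj: "\<And>k y. L y = b \<Longrightarrow> (norm (p k - y))\<^sup>2 = (norm (x (Suc k) - y))\<^sup>2 + (norm (x (Suc k) - p k))\<^sup>2"
  shows "\<exists>xs us. L xs = b \<and> - adjoint L us \<in> subdifferential f xs \<and> x \<longlonglongrightarrow> xs \<and> u \<longlonglongrightarrow> us"
proof -
  have bl: "bounded_linear L" using L by (simp add: linear_conv_bounded_linear)
  define \<kappa> where "\<kappa> = onorm L * sqrt (\<gamma> * \<tau>)"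
  have "\<kappa>\<^sup>2 < 1\<^sup>2" using step pos by (simp add: \<kappa>_def power_mult_distrib mult.commute)
  then have \<kappa>: "\<kappa> < 1" by (rule power_less_imp_less_base) simp
  define E where "E xs us k = pd_energy L \<tau> \<gamma> xs us (x k) (u k) (q k)" for xs us k
  define \<delta> where "\<delta> k = (norm (x (Suc k) - p k))\<^sup>2 / \<tau>
      + (1 - \<kappa>) * ((norm (u (Suc k) - u k))\<^sup>2 / \<gamma> + (norm (q k))\<^sup>2 / \<tau>)" for k
  have low: "(1 - \<kappa>) * ((norm (x k - xs))\<^sup>2 / \<tau> + (norm (u k - us))\<^sup>2 / \<gamma> + (norm (q k))\<^sup>2 / \<tau>) \<le> E xs us k" for xs us k
    unfolding E_def \<kappa>_def by (rule pd_energy_lower_bound[OF bl pos])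
  have E0: "0 \<le> E xs us k" for xs us k
    by (rule order_trans[OF _ low]) (use \<kappa> pos in auto)
  have \<delta>0: "0 \<le> \<delta> k" for k using \<kappa> pos by (auto simp: \<delta>_def)
  \<comment> \<open>Stated for an arbitrary saddle point: it is applied first to the given one, for
    boundedness, and later to the cluster point.\<close>
  have dec: "E xs us (Suc k) + \<delta> k \<le> E xs us k"
    if s: "L xs = b" "- adjoint L us \<in> subdifferential f xs" for xs us k
  proof -
    have "0 \<le> (p k - xs) \<bullet> ((1 / \<tau>) *\<^sub>R (x k - p k) - adjoint L (u (Suc k)) - - adjoint L us)"
      by (rule subdifferential_monotone[OF pf p s(2)])
    also have "\<dots> = (x k - p k) \<bullet> (p k - xs) / \<tau> - L (p k - xs) \<bullet> (u (Suc k) - us)"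
    proof -
      have "w \<bullet> ((1 / \<tau>) *\<^sub>R v - adjoint L a - - adjoint L us) = v \<bullet> w / \<tau> - L w \<bullet> (a - us)" for v w a
        by (simp add: inner_diff_right inner_add_right adjoint_works[OF L] inner_commute[of v w])
      then show ?thesis .
    qed
    finally have mono: "\<tau> * (L (p k - xs) \<bullet> (u (Suc k) - us)) \<le> (x k - p k) \<bullet> (p k - xs)"
      using pos by (simp add: field_simps)
    have "pd_energy L \<tau> \<gamma> xs us (x (Suc k)) (u (Suc k)) (p k - x k) + (norm (x (Suc k) - p k))\<^sup>2 / \<tau>
      + (1 - onorm L * sqrt (\<gamma> * \<tau>)) * ((norm (u (Suc k) - u k))\<^sup>2 / \<gamma> + (norm (q k))\<^sup>2 / \<tau>)
      \<le> pd_energy L \<tau> \<gamma> xs us (x k) (u k) (q k)"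
      by (rule pd_energy_decrease[OF bl pos _ mono proj[OF s(1)]]) (simp add: u s(1))
    then show ?thesis by (simp add: E_def \<delta>_def \<kappa>_def q)
  qed
  have xbd: "(norm (x k - xs))\<^sup>2 \<le> \<tau> / (1 - \<kappa>) * E xs us k"
    and ubd: "(norm (u k - us))\<^sup>2 \<le> \<gamma> / (1 - \<kappa>) * E xs us k" for xs us k
  proof -
    have "(1 - \<kappa>) * ((norm (x k - xs))\<^sup>2 / \<tau>) \<le> E xs us k"
      by (rule order_trans[OF mult_left_mono low]) (use \<kappa> pos in auto)
    moreover have "(1 - \<kappa>) * ((norm (u k - us))\<^sup>2 / \<gamma>) \<le> E xs us k"
      by (rule order_trans[OF mult_left_mono low]) (use \<kappa> pos in auto)
    ultimately show "(norm (x k - xs))\<^sup>2 \<le> \<tau> / (1 - \<kappa>) * E xs us k"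
      "(norm (u k - us))\<^sup>2 \<le> \<gamma> / (1 - \<kappa>) * E xs us k"
      using \<kappa> pos by (auto simp: field_simps)
  qed
  have \<delta>lim: "\<delta> \<longlonglongrightarrow> 0"
    by (rule energy_decrements_vanish(2)[where E = "E xh uh"]) (use E0 \<delta>0 dec[OF saddle] in auto)
  have qlim: "q \<longlonglongrightarrow> 0"
  proof (rule tendsto_of_norm_square_le[OF \<delta>lim, of _ _ "\<tau> / (1 - \<kappa>)"])
    fix k
    have "(1 - \<kappa>) * ((norm (q k))\<^sup>2 / \<tau>) \<le> \<delta> k" unfolding \<delta>_def using \<kappa> pos
      by (simp add: distrib_left)
    then show "(norm (q k - 0))\<^sup>2 \<le> \<tau> / (1 - \<kappa>) * \<delta> k" using \<kappa> pos by (simp add: field_simps)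
  qed
  have ulim: "(\<lambda>k. u (Suc k) - u k) \<longlonglongrightarrow> 0"
  proof (rule tendsto_of_norm_square_le[OF \<delta>lim, of _ _ "\<gamma> / (1 - \<kappa>)"])
    fix k
    have "(1 - \<kappa>) * ((norm (u (Suc k) - u k))\<^sup>2 / \<gamma>) \<le> \<delta> k" unfolding \<delta>_def using \<kappa> pos
      by (simp add: distrib_left)
    then show "(norm (u (Suc k) - u k - 0))\<^sup>2 \<le> \<gamma> / (1 - \<kappa>) * \<delta> k" using \<kappa> pos by (simp add: field_simps)
  qed
  have "decseq (E xh uh)" using dec[OF saddle] \<delta>0 by (intro decseq_SucI) (smt (verit))
  then have Eb: "E xh uh k \<le> E xh uh 0" for k by (simp add: decseqD)
  define B where "B = sqrt (\<tau> / (1 - \<kappa>) * E xh uh 0)"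
  define C where "C = sqrt (\<gamma> / (1 - \<kappa>) * E xh uh 0)"
  have "(norm (x k - xh))\<^sup>2 \<le> \<tau> / (1 - \<kappa>) * E xh uh 0" for k
    by (rule order_trans[OF xbd mult_left_mono[OF Eb]]) (use \<kappa> pos in auto)
  then have xB: "x k \<in> cball xh B" for k
    by (simp add: B_def dist_norm norm_minus_commute real_le_rsqrt)
  have "(norm (u k - uh))\<^sup>2 \<le> \<gamma> / (1 - \<kappa>) * E xh uh 0" for k
    by (rule order_trans[OF ubd mult_left_mono[OF Eb]]) (use \<kappa> pos in auto)
  then have uC: "u k \<in> cball uh C" for k
    by (simp add: C_def dist_norm norm_minus_commute real_le_rsqrt)
  have "seq_compact (cball xh B \<times> cball uh C)"
    by (intro compact_imp_seq_compact compact_Times compact_cball)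
  moreover have "\<forall>k. (x k, u k) \<in> cball xh B \<times> cball uh C" using xB uC by blast
  ultimately obtain l r where r: "strict_mono (r :: nat \<Rightarrow> nat)" and l: "((\<lambda>k. (x k, u k)) \<circ> r) \<longlonglongrightarrow> l"
    by (meson seq_compactE)
  define xs us where "xs = fst l" and "us = snd l"
  have xr: "(\<lambda>k. x (r k)) \<longlonglongrightarrow> xs" using tendsto_fst[OF l] by (simp add: xs_def o_def)
  have ur: "(\<lambda>k. u (r k)) \<longlonglongrightarrow> us" using tendsto_snd[OF l] by (simp add: us_def o_def)
  have qr: "(\<lambda>k. q (r k)) \<longlonglongrightarrow> 0" using LIMSEQ_subseq_LIMSEQ[OF qlim r] by (simp add: o_def)
  have qr': "(\<lambda>k. q (Suc (r k))) \<longlonglongrightarrow> 0"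
    using LIMSEQ_subseq_LIMSEQ[OF LIMSEQ_Suc[OF qlim] r] by (simp add: o_def)
  have dr: "(\<lambda>k. u (Suc (r k)) - u (r k)) \<longlonglongrightarrow> 0"
    using LIMSEQ_subseq_LIMSEQ[OF ulim r] by (simp add: o_def)
  have ur': "(\<lambda>k. u (Suc (r k))) \<longlonglongrightarrow> us" using tendsto_add[OF dr ur] by simp
  \<comment> \<open>\<open>p (r k)\<close> is \<open>q (Suc (r k)) + x (r k)\<close>, so the
    vanishing of the shifted \<open>q\<close> sends it to the same cluster point.\<close>
  have pr: "(\<lambda>k. p (r k)) \<longlonglongrightarrow> xs" using tendsto_add[OF qr' xr] by (simp add: q)
  have contL: "(\<lambda>k. L (v k)) \<longlonglongrightarrow> L a" if "v \<longlonglongrightarrow> a" for v and a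
    using bounded_linear.tendsto[OF bl that] .
  \<comment> \<open>The increment of \<open>u\<close> is \<gamma> times the residual of the
    constraint at \<open>x + q\<close>; as it vanishes, the cluster point is feasible.\<close>
  have "(\<lambda>k. \<gamma> *\<^sub>R (L (x (r k) + q (r k)) - b)) \<longlonglongrightarrow> \<gamma> *\<^sub>R (L (xs + 0) - b)"
    by (intro tendsto_intros contL xr qr)
  moreover have "(\<lambda>k. \<gamma> *\<^sub>R (L (x (r k) + q (r k)) - b)) \<longlonglongrightarrow> 0" using dr by (simp add: u)
  ultimately have "\<gamma> *\<^sub>R (L (xs + 0) - b) = 0" using LIMSEQ_unique by blast
  then have sol: "L xs = b" using pos by simp
  have bla: "bounded_linear (adjoint L)"
    using adjoint_linear[OF L] by (simp add: linear_conv_bounded_linear)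
  have sub: "- adjoint L us \<in> subdifferential f xs"
  proof (rule subdifferential_closed_graph[OF pf lsc pr])
    have "(\<lambda>k. (1 / \<tau>) *\<^sub>R (x (r k) - p (r k)) - adjoint L (u (Suc (r k))))
      \<longlonglongrightarrow> (1 / \<tau>) *\<^sub>R (xs - xs) - adjoint L us"
      by (intro tendsto_intros xr pr bounded_linear.tendsto[OF bla] ur')
    then show "(\<lambda>k. (1 / \<tau>) *\<^sub>R (x (r k) - p (r k)) - adjoint L (u (Suc (r k)))) \<longlonglongrightarrow> - adjoint L us"
      by simp
  qed (rule p)
  have "convergent (E xs us)"
    by (rule energy_decrements_vanish(1)[where \<delta> = \<delta>]) (use E0 \<delta>0 dec[OF sol sub] in auto)
  then obtain e where e: "E xs us \<longlonglongrightarrow> e" by (auto simp: convergent_def)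
  \<comment> \<open>Relative to the cluster point, every term of the energy vanishes along
    \<open>r\<close>, which identifies the limit \<open>e\<close> of the whole sequence as
    0.\<close>
  have "(\<lambda>k. E xs us (r k)) \<longlonglongrightarrow>
      (norm (xs - xs))\<^sup>2 / \<tau> + (norm (us - us))\<^sup>2 / \<gamma> + 2 * ((us - us) \<bullet> L 0) + (norm (0::'a))\<^sup>2 / \<tau>"
    unfolding E_def pd_energy_def using pos
    by (intro tendsto_intros xr ur qr contL) auto
  moreover have "(\<lambda>k. E xs us (r k)) \<longlonglongrightarrow> e"
    using LIMSEQ_subseq_LIMSEQ[OF e r] by (simp add: o_def)
  ultimately have "e = 0" using LIMSEQ_unique by fastforce
  with e have E: "E xs us \<longlonglongrightarrow> 0" by simp
  have "x \<longlonglongrightarrow> xs" "u \<longlonglongrightarrow> us"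
    by (rule tendsto_of_norm_square_le[OF E xbd] tendsto_of_norm_square_le[OF E ubd])+
  with sol sub show ?thesis by blast
qed

section \<open>The projection onto the first constraint, and the theorem\<close>

text \<open>\<open>p - x\<close> lies in the range of \<open>transpose R\<close>, while
  \<open>x\<close> and \<open>y\<close> both satisfy the constraint, so \<open>x - y\<close> lies in
  the kernel of \<open>R\<close>; these two spaces are orthogonal.\<close>

lemma affine_projection_pythagoras:
  fixes R :: "real ^ 'n ^ 'm"
  assumes inv: "invertible (R ** transpose R)"
    and x: "x = p - transpose R *v (matrix_inv (R ** transpose R) *v (R *v p - c))"
    and y: "R *v y = c"
  shows "(norm (p - y))\<^sup>2 = (norm (x - y))\<^sup>2 + (norm (x - p))\<^sup>2"
proof -
  let ?w = "matrix_inv (R ** transpose R) *v (R *v p - c)"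
  have "R *v (transpose R *v ?w) = (R ** transpose R ** matrix_inv (R ** transpose R)) *v (R *v p - c)"
    by (simp add: matrix_vector_mul_assoc matrix_mul_assoc)
  \<comment> \<open>\<open>matrix_inv\<close> is a Hilbert choice; invertibility makes the chosen
    matrix an inverse.\<close>
  also have "R ** transpose R ** matrix_inv (R ** transpose R) = mat 1"
    using inv unfolding invertible_def matrix_inv_def by (metis (mono_tags, lifting) someI_ex)
  finally have "R *v (transpose R *v ?w) = R *v p - c" by simp
  then have "R *v (x - y) = 0" by (simp add: x y matrix_vector_mult_diff_distrib)
  then have "(x - y) \<bullet> (transpose R *v ?w) = 0"
    by (metis dot_lmul_matrix inner_commute inner_zero_left transpose_matrix_vector)
  then have "(x - y) \<bullet> (p - x) = 0" by (simp add: x)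
  then show ?thesis
    using norm_add_Pythagorean[of "x - y" "p - x"] by (simp add: orthogonal_def norm_minus_commute)
qed

theorem corollary4p2:
  fixes f :: "real ^ 'N \<Rightarrow> ereal"
    and R :: "real ^ 'N ^ 'm" and S :: "real ^ 'N ^ 'n"
    and c :: "real ^ 'm" and d :: "real ^ 'n"
    and L :: "real ^ 'N \<Rightarrow> (real ^ 'm) \<times> (real ^ 'n)"
    and b :: "(real ^ 'm) \<times> (real ^ 'n)"
    and \<gamma> \<tau> :: real
    and x xbar p :: "nat \<Rightarrow> real ^ 'N"
    and u :: "nat \<Rightarrow> (real ^ 'm) \<times> (real ^ 'n)"
  assumes "proper_fun f" and "lsc_fun f" and "econvex_fun f"
    and "invertible (R ** transpose R)"
    and "L = (\<lambda>z. (R *v z, S *v z))" and "b = (c, d)"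
    and "\<exists>z. is_arg_min f (\<lambda>y. R *v y = c \<and> S *v y = d) z"
    and "0 \<in> rel_interior ((\<lambda>z. L z - b) ` edom f)"
    and "\<gamma> > 0" and "\<tau> > 0" and "\<gamma> * \<tau> * (onorm L)\<^sup>2 < 1"
    and "x 0 = xbar 0"
    and "\<And>k. u (Suc k) = u k + \<gamma> *\<^sub>R (L (xbar k) - b)"
    and "\<And>k. p (Suc k) = prox \<tau> f (x k - \<tau> *\<^sub>R adjoint L (u (Suc k)))"
    and "\<And>k. x (Suc k) = p (Suc k)
           - transpose R *v (matrix_inv (R ** transpose R) *v (R *v p (Suc k) - c))"
    and "\<And>k. xbar (Suc k) = x (Suc k) + p (Suc k) - x k"
  shows "\<exists>xhat uhat. is_arg_min f (\<lambda>y. R *v y = c \<and> S *v y = d) xhat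
           \<and> - adjoint L uhat \<in> subdifferential f xhat
           \<and> x \<longlonglongrightarrow> xhat \<and> u \<longlonglongrightarrow> uhat"
proof -
  have L: "linear L"
    unfolding \<open>L = _\<close> by (intro linearI) (simp_all add: matrix_vector_right_distrib matrix_vector_mult_scaleR)
  have feasible: "(R *v y = c \<and> S *v y = d) = (L y = b)" for y
    by (simp add: \<open>L = _\<close> \<open>b = _\<close>)
  obtain xh where xh: "is_arg_min f (\<lambda>y. L y = b) xh"
    using assms(7) unfolding feasible by blast
  then obtain uh where uh: "- adjoint L uh \<in> subdifferential f xh"
    using multiplier_exists[OF assms(1,3) L _ assms(8)] by blast
  have "L xh = b" using xh by (simp add: is_arg_min_def)
  have "\<exists>xs us. L xs = b \<and> - adjoint L us \<in> subdifferential f xs \<and> x \<longlonglongrightarrow> xs \<and> u \<longlonglongrightarrow> us"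
  \<comment> \<open>The index of \<open>p\<close> shifts by one, since \<open>p (Suc k)\<close> is
    computed from \<open>x k\<close>.\<close>
  proof (rule projected_primal_dual_convergence[OF assms(1,2) L assms(9-11) \<open>L xh = b\<close> uh,
        where q = "\<lambda>k. xbar k - x k" and p = "\<lambda>k. p (Suc k)"])
    fix k
    show "u (Suc k) = u k + \<gamma> *\<^sub>R (L (x k + (xbar k - x k)) - b)"
      using assms(13)[of k] by simp
    show "xbar (Suc k) - x (Suc k) = p (Suc k) - x k"
      using assms(16)[of k] by simp
    \<comment> \<open>The multiplier \<open>uh\<close> provides the subgradient that guarantees the
      proximal point.\<close>
    have "(1 / \<tau>) *\<^sub>R (x k - \<tau> *\<^sub>R adjoint L (u (Suc k)) - p (Suc k)) \<in> subdifferential f (p (Suc k))"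
      unfolding assms(14) by (rule prox_subdifferential[OF assms(1-3,10) uh])
    then show "(1 / \<tau>) *\<^sub>R (x k - p (Suc k)) - adjoint L (u (Suc k)) \<in> subdifferential f (p (Suc k))"
      using \<open>\<tau> > 0\<close> by (simp add: scaleR_diff_right algebra_simps)
    fix y assume "L y = b"
    then have "R *v y = c" using feasible by blast
    then show "(norm (p (Suc k) - y))\<^sup>2 = (norm (x (Suc k) - y))\<^sup>2 + (norm (x (Suc k) - p (Suc k)))\<^sup>2"
      by (rule affine_projection_pythagoras[OF assms(4,15)])
  qed
  then obtain xs us where s: "L xs = b" "- adjoint L us \<in> subdifferential f xs" "x \<longlonglongrightarrow> xs" "u \<longlonglongrightarrow> us"
    by blast
  \<comment> \<open>Differences of feasible points lie in the kernel of \<open>L\<close>, hence are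
    orthogonal to \<open>adjoint L us\<close>; the subgradient inequality then reduces to
    minimality.\<close>
  have "f xs \<le> f y" if "L y = b" for y
  proof -
    have "(y - xs) \<bullet> (- adjoint L us) = 0"
      using adjoint_works[OF L, of "y - xs" us] that s(1) by (simp add: linear_diff[OF L])
    then show ?thesis using subdifferentialD[OF s(2), of y] by (simp flip: zero_ereal_def)
  qed
  then have "is_arg_min f (\<lambda>y. L y = b) xs" using s(1) by (auto simp: is_arg_min_def not_less)
  then show ?thesis unfolding feasible using s by blast
qed

end
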